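(* Let $\alpha\in[0,2)$ and $\mu(\alpha):=\frac{(1-\alpha)^2}{4}$. Then for all $u\in C^\infty_c(0,1)$, $$\int_0^1 x^2u_x^2\,dx\le\int_0^1\Big(x^\alpha u_x^2-\mu(\alpha)\frac{u^2}{x^{2-\alpha}}\Big)\,dx+\frac{(1-\alpha)(\alpha-3)}{4}\int_0^1u^2\,dx.$$
   Context: $C^\infty_c(0,1)$ denotes the real-valued infinitely smooth functions with compact support in the open interval $(0,1)$; $u_x$ is the derivative of $u$. *)

theory Defs
  imports "HOL-Analysis.Analysis"
begin

text \<open>
  Real-valued test functions on an open set \<open>\<Omega>\<close> of reals. Functions are total in HOL; only
  the values on \<open>\<Omega>\<close> matter. The support is the closure of the non-vanishing set relative to
  \<open>\<Omega>\<close>, so its compactness keeps it away from the boundary of \<open>\<Omega>\<close>.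
\<close>

definition smooth_on :: "real set \<Rightarrow> (real \<Rightarrow> real) \<Rightarrow> bool" where
  "smooth_on \<Omega> u \<longleftrightarrow> (\<forall>n. \<forall>x\<in>\<Omega>. (deriv ^^ n) u field_differentiable at x)"

definition support_in :: "real set \<Rightarrow> (real \<Rightarrow> real) \<Rightarrow> real set" where
  "support_in \<Omega> u = \<Omega> \<inter> closure {x \<in> \<Omega>. u x \<noteq> 0}"

definition Cinf_c :: "real set \<Rightarrow> (real \<Rightarrow> real) set" where
  "Cinf_c \<Omega> = {u. smooth_on \<Omega> u \<and> compact (support_in \<Omega> u)}"

definition \<mu> :: "real \<Rightarrow> real" where
  "\<mu> \<alpha> = (1 - \<alpha>)\<^sup>2 / 4"

end

theory Submission
  imports Defs
begin

text \<open>
  Put \<open>\<beta> = (1 - \<alpha>) / 2\<close>, the exponent of the Hardy ground state \<open>x powr \<beta>\<close>. The right-hand integrands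
  minus the left-hand one equal \<open>(x powr \<alpha> - x\<^sup>2) * (u' - \<beta> * u / x)\<^sup>2\<close> plus the derivative of
  \<open>\<beta> * (x powr (\<alpha> - 1) - x) * u\<^sup>2\<close>. The square has a nonnegative weight on \<open>(0,1)\<close> because \<open>\<alpha> \<le> 2\<close>,
  and the derivative integrates to zero because \<open>u\<close> is compactly supported.
\<close>

lemma Cinf_c_differentiable:
  assumes "u \<in> Cinf_c \<Omega>" "x \<in> \<Omega>"
  shows "(u has_real_derivative deriv u x) (at x)"
proof -
  have "(deriv ^^ 0) u field_differentiable at x"
    using assms unfolding Cinf_c_def smooth_on_def by blast
  then show ?thesis
    by (simp add: DERIV_deriv_iff_field_differentiable)
qed

lemma Cinf_c_continuous_deriv:
  assumes "u \<in> Cinf_c \<Omega>"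
  shows "continuous_on \<Omega> (deriv u)"
proof -
  have "(deriv ^^ 1) u field_differentiable at x" if "x \<in> \<Omega>" for x
    using assms that unfolding Cinf_c_def smooth_on_def by blast
  then show ?thesis
    by (intro continuous_at_imp_continuous_on)
       (simp add: field_differentiable_imp_continuous_at)
qed

text \<open>Within \<open>\<Omega>\<close>, the complement of the closure is an open neighbourhood
  of \<open>x\<close> on which \<open>u\<close> agrees with the zero function.\<close>

lemma eq_0_outside_support_in:
  assumes "open \<Omega>" "x \<in> \<Omega>" "x \<notin> support_in \<Omega> u"
  shows "u x = 0" "deriv u x = 0"
proof -
  let ?N = "\<Omega> - closure {x \<in> \<Omega>. u x \<noteq> 0}"
  have N: "open ?N" "x \<in> ?N"
    using assms by (auto simp: support_in_def open_Diff)
  have zero: "u y = 0" if "y \<in> ?N" for y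
    using that closure_subset[of "{x \<in> \<Omega>. u x \<noteq> 0}"] by auto
  show "u x = 0"
    using zero N(2) .
  have "(u has_real_derivative 0) (at x)"
    by (rule has_field_derivative_transform_within_open[OF DERIV_const[of 0] N]) (erule zero[symmetric])
  then show "deriv u x = 0"
    by (rule DERIV_imp_deriv)
qed

text \<open>A compact subset of an open interval attains its extrema, so it stays away from
  \<open>l\<close> and \<open>r\<close>. Excluding only the open interval makes \<open>u\<close>
  vanish at \<open>a\<close> and \<open>b\<close> too.\<close>

lemma Cinf_c_open_interval_support:
  assumes "u \<in> Cinf_c {l<..<r}" "l < r"
  obtains a b where "l < a" "a < b" "b < r"
    "\<And>x. l < x \<Longrightarrow> x < r \<Longrightarrow> x \<notin> {a<..<b} \<Longrightarrow> u x = 0 \<and> deriv u x = 0"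
proof -
  \<comment> \<open>The midpoint keeps the set nonempty when \<open>u\<close> vanishes on the whole
    interval.\<close>
  let ?K = "insert ((l + r) / 2) (support_in {l<..<r} u)"
  have K: "compact ?K" "?K \<noteq> {}" "?K \<subseteq> {l<..<r}"
    using assms by (auto simp: Cinf_c_def support_in_def)
  obtain m where m: "m \<in> ?K" "\<And>t. t \<in> ?K \<Longrightarrow> m \<le> t"
    using compact_attains_inf[OF K(1,2)] by blast
  obtain M where M: "M \<in> ?K" "\<And>t. t \<in> ?K \<Longrightarrow> t \<le> M"
    using compact_attains_sup[OF K(1,2)] by blast
  have bounds: "l < m" "m \<le> M" "M < r"
    using m M K(3) by auto
  \<comment> \<open>Going halfway from the extrema to \<open>l\<close> and \<open>r\<close> puts the
    support strictly inside and keeps the two bounds distinct even if \<open>m = M\<close>.\<close>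
  have "u x = 0 \<and> deriv u x = 0"
    if "l < x" "x < r" "x \<notin> {(l + m) / 2<..<(M + r) / 2}" for x
  proof -
    have "x \<notin> support_in {l<..<r} u"
      using that bounds m(2)[of x] M(2)[of x] by auto
    then show ?thesis
      using that eq_0_outside_support_in[of "{l<..<r}" x u] by auto
  qed
  with bounds show thesis
    by (intro that[of "(l + m) / 2" "(M + r) / 2"]) auto
qed

lemma set_lebesgue_integral_eq_subset:
  fixes f :: "'a \<Rightarrow> 'b :: {banach, second_countable_topology}"
  assumes "A \<subseteq> B" "\<And>x. x \<in> B - A \<Longrightarrow> f x = 0"
  shows "(LINT x:B|M. f x) = (LINT x:A|M. f x)"
  unfolding set_lebesgue_integral_def
  by (rule Bochner_Integration.integral_cong) (use assms in \<open>auto simp: indicator_def\<close>)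

text \<open>Pointwise algebra, with \<open>q\<close> for the value of \<open>u\<close> and
  \<open>p\<close> for its derivative; the last bracket is the derivative term expanded by the
  product rule.\<close>

lemma hardy_ground_state_identity:
  fixes x p q \<alpha> :: real
  assumes "0 < x"
  defines "\<beta> \<equiv> (1 - \<alpha>) / 2"
  shows "x powr \<alpha> * p\<^sup>2 - \<mu> \<alpha> * (q\<^sup>2 / x powr (2 - \<alpha>))
      + (1 - \<alpha>) * (\<alpha> - 3) / 4 * q\<^sup>2 - x\<^sup>2 * p\<^sup>2
    = (x powr \<alpha> - x\<^sup>2) * (p - \<beta> * q / x)\<^sup>2
      + (\<beta> * ((\<alpha> - 1) * x powr (\<alpha> - 2) - 1) * q\<^sup>2
        + \<beta> * (x powr (\<alpha> - 1) - x) * (2 * q * p))"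
proof -
  \<comment> \<open>Written with \<open>y\<close> and the quotient \<open>r = q / x\<close>, both
    sides become polynomials in \<open>x\<close>, \<open>y\<close>, \<open>r\<close>,
    \<open>p\<close> and \<open>\<beta>\<close>.\<close>
  define y where "y = x powr (\<alpha> - 2)"
  have "x powr \<alpha> = x powr ((\<alpha> - 2) + 2)" "x powr (\<alpha> - 1) = x powr ((\<alpha> - 2) + 1)"
    by simp_all
  then have y: "x powr \<alpha> = y * x\<^sup>2" "x powr (\<alpha> - 1) = y * x"
    using assms(1) unfolding powr_add y_def by simp_all
  have q: "q\<^sup>2 / x powr (2 - \<alpha>) = q\<^sup>2 * y"
    unfolding y_def using powr_minus_divide[of x "2 - \<alpha>"] by simp
  define r where "r = q / x"
  then have r: "\<beta> * q / x = \<beta> * r" "q = r * x"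
    using assms(1) by simp_all
  have \<alpha>: "\<alpha> = 1 - 2 * \<beta>"
    by (simp add: \<beta>_def field_simps)
  show ?thesis
    unfolding y q r(1) y_def[symmetric] \<mu>_def unfolding r(2) \<alpha>
    by (simp add: field_simps power2_eq_square)
qed

theorem theorem1p1:
  fixes \<alpha> :: real and u :: "real \<Rightarrow> real"
  assumes "\<alpha> \<in> {0..<2}"
    and "u \<in> Cinf_c {0<..<1}"
  shows "(LINT x:{0<..<1}|lborel. x\<^sup>2 * (deriv u x)\<^sup>2)
    \<le> (LINT x:{0<..<1}|lborel.
          x powr \<alpha> * (deriv u x)\<^sup>2 - \<mu> \<alpha> * ((u x)\<^sup>2 / x powr (2 - \<alpha>)))
      + (1 - \<alpha>) * (\<alpha> - 3) / 4 * (LINT x:{0<..<1}|lborel. (u x)\<^sup>2)"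
proof -
  obtain a b where ab: "0 < a" "a < b" "b < 1"
    and zero: "\<And>x. 0 < x \<Longrightarrow> x < 1 \<Longrightarrow> x \<notin> {a<..<b} \<Longrightarrow> u x = 0 \<and> deriv u x = 0"
    using Cinf_c_open_interval_support[OF assms(2)] by auto
  define \<beta> where "\<beta> = (1 - \<alpha>) / 2"
  define c where "c = (1 - \<alpha>) * (\<alpha> - 3) / 4"
  define L where "L x = x\<^sup>2 * (deriv u x)\<^sup>2" for x
  define R where "R x = x powr \<alpha> * (deriv u x)\<^sup>2 - \<mu> \<alpha> * ((u x)\<^sup>2 / x powr (2 - \<alpha>))" for x
  define S where "S x = (x powr \<alpha> - x\<^sup>2) * (deriv u x - \<beta> * u x / x)\<^sup>2" for x
  define F where "F x = \<beta> * (x powr (\<alpha> - 1) - x) * (u x)\<^sup>2" for x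
  define F' where "F' x = \<beta> * ((\<alpha> - 1) * x powr (\<alpha> - 2) - 1) * (u x)\<^sup>2
    + \<beta> * (x powr (\<alpha> - 1) - x) * (2 * u x * deriv u x)" for x
  have der: "(u has_real_derivative deriv u x) (at x)" if "a \<le> x" "x \<le> b" for x
    using Cinf_c_differentiable[OF assms(2)] ab that by simp
  have cont_u: "continuous_on {a..b} u"
    by (rule DERIV_continuous_on) (use der in \<open>auto intro: has_field_derivative_at_within\<close>)
  have cont_du: "continuous_on {a..b} (deriv u)"
    by (rule continuous_on_subset[OF Cinf_c_continuous_deriv[OF assms(2)]]) (use ab in auto)
  \<comment> \<open>Since \<open>a > 0\<close>, the singular powers of \<open>x\<close> are
    continuous on the compact interval, which gives integrability.\<close>
  have cont: "continuous_on {a..b} L" "continuous_on {a..b} R"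
    "continuous_on {a..b} F'" "continuous_on {a..b} (\<lambda>x. (u x)\<^sup>2)"
    unfolding L_def R_def F'_def
    by (intro continuous_intros cont_u cont_du; use ab in \<open>auto simp: not_le\<close>)+
  note int = cont[THEN borel_integrable_atLeastAtMost']
  have restrict: "(LINT x:{0<..<1}|lborel. f x) = (LINT x:{a..b}|lborel. f x)"
    if "\<And>x. u x = 0 \<Longrightarrow> deriv u x = 0 \<Longrightarrow> f x = 0" for f :: "real \<Rightarrow> real"
    by (rule set_lebesgue_integral_eq_subset) (use ab zero that in auto)
  have "(LINT x:{a..b}|lborel. F' x) = F b - F a"
    unfolding set_lebesgue_integral_def
  proof (rule integral_FTC_atLeastAtMost)
    fix x assume x: "a \<le> x" "x \<le> b"
    have "(F has_real_derivative F' x) (at x)"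
      unfolding F_def F'_def
      by (rule derivative_eq_intros der x refl | use x ab in simp)+
    then show "(F has_vector_derivative F' x) (at x within {a..b})"
      by (simp add: has_real_derivative_iff_has_vector_derivative has_vector_derivative_at_within)
  qed (use ab cont in auto)
  also have "\<dots> = 0"
    \<comment> \<open>The end points lie outside the open interval, so both boundary terms
      vanish.\<close>
    using zero[of a] zero[of b] ab by (simp add: F_def)
  finally have F'0: "(LINT x:{a..b}|lborel. F' x) = 0" .
  \<comment> \<open>Adding this zero integral on the left reduces the claim to a pointwise
    comparison of integrands.\<close>
  have "(LINT x:{a..b}|lborel. L x) + (LINT x:{a..b}|lborel. F' x)
      = (LINT x:{a..b}|lborel. L x + F' x)"
    by (rule set_integral_add(2)[symmetric]) (use int in auto)
  also have "\<dots> \<le> (LINT x:{a..b}|lborel. R x + c * (u x)\<^sup>2)"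
  proof (rule set_integral_mono)
    fix x assume x: "x \<in> {a..b}"
    \<comment> \<open>For a base in \<open>(0,1)\<close> the larger exponent gives the smaller
      power.\<close>
    have "x powr 2 \<le> x powr \<alpha>"
      using x ab assms(1) by (intro powr_mono') auto
    then have "0 \<le> S x"
      using x ab by (simp add: S_def)
    then show "L x + F' x \<le> R x + c * (u x)\<^sup>2"
      using hardy_ground_state_identity[of x \<alpha> "deriv u x" "u x"] x ab
      unfolding L_def R_def F'_def S_def c_def \<beta>_def by simp
  qed (intro set_integral_add(1) set_integrable_mult_right int)+
  also have "\<dots> = (LINT x:{a..b}|lborel. R x) + c * (LINT x:{a..b}|lborel. (u x)\<^sup>2)"
    by (subst set_integral_add(2)) (simp_all add: int)
  finally show ?thesis
    using F'0 restrict[of L] restrict[of R] restrict[of "\<lambda>x. (u x)\<^sup>2"]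
    by (simp add: L_def R_def c_def)
qed

end
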